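(* Let $n$ be a positive integer and let $D\subseteq [n]^2$ be the odd diagram of some permutation in $\mathfrak{S}_n$. Then the set $\{w\in\mathfrak{S}_n : D_o(w)=D\}$ is an interval in the Bruhat order; that is, there exist $u,v\in\mathfrak{S}_n$ with $u\le v$ such that $$\{w\in\mathfrak{S}_n : D_o(w)=D\}=[u,v]=\{w\in\mathfrak{S}_n : u\le w\le v\}.$$
   Context: $\mathfrak{S}_n$ is the symmetric group on $[n]=\{1,\dots,n\}$, with length $\ell(w)=|\{(i,j)\in[n]^2: i<j,\ w(i)>w(j)\}|$. The Bruhat order $\le$ on $\mathfrak{S}_n$ is the (reflexive) transitive closure of the relation $u\to v$ defined by: $vu^{-1}$ is a transposition and $\ell(u)<\ell(v)$. The diagram of $w\in\mathfrak{S}_n$ is $D(w)=\{(i,j)\in[n]^2 : j<w(i),\ w^{-1}(j)>i\}$, and the odd diagram of $w$ is $D_o(w)=\{(i,j)\in D(w): i\not\equiv w^{-1}(j) \pmod 2\}$. *)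

theory Defs
  imports "HOL-Combinatorics.Permutations"
begin

(* A permutation of [n] is a function w :: nat \<Rightarrow> nat with w permutes {1..n}; it fixes every
   point outside {1..n}, so inv w is the group inverse and (\<circ>) the group product. *)

definition perm_length :: "nat \<Rightarrow> (nat \<Rightarrow> nat) \<Rightarrow> nat" where
  "perm_length n w = card {(i, j). i \<in> {1..n} \<and> j \<in> {1..n} \<and> i < j \<and> w i > w j}"

definition bruhat_step :: "nat \<Rightarrow> (nat \<Rightarrow> nat) \<Rightarrow> (nat \<Rightarrow> nat) \<Rightarrow> bool" where
  "bruhat_step n u v \<longleftrightarrow>
     u permutes {1..n} \<and> v permutes {1..n} \<and>
     (\<exists>a\<in>{1..n}. \<exists>b\<in>{1..n}. a \<noteq> b \<and> v \<circ> inv u = transpose a b) \<and>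
     perm_length n u < perm_length n v"

(* The conjuncts u, v permutes {1..n} keep the reflexive closure inside the symmetric group. *)
definition bruhat_le :: "nat \<Rightarrow> (nat \<Rightarrow> nat) \<Rightarrow> (nat \<Rightarrow> nat) \<Rightarrow> bool" where
  "bruhat_le n u v \<longleftrightarrow>
     u permutes {1..n} \<and> v permutes {1..n} \<and> (bruhat_step n)\<^sup>*\<^sup>* u v"

definition diagram :: "nat \<Rightarrow> (nat \<Rightarrow> nat) \<Rightarrow> (nat \<times> nat) set" where
  "diagram n w = {(i, j). i \<in> {1..n} \<and> j \<in> {1..n} \<and> j < w i \<and> inv w j > i}"

definition odd_diagram :: "nat \<Rightarrow> (nat \<Rightarrow> nat) \<Rightarrow> (nat \<times> nat) set" where
  "odd_diagram n w = {(i, j). (i, j) \<in> diagram n w \<and> i mod 2 \<noteq> inv w j mod 2}"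

end

theory Submission
  imports Defs "HOL-Library.Infinite_Set"
begin

text \<open>Fix an odd diagram and call the set of permutations that have it a class. That a class is an
interval splits into two independent facts: the class has a least and a greatest element, and
every permutation between two members of the class is itself a member.

For the first fact, take two different members and the smallest value on which their inverses
differ, say at places \<open>p < q\<close>. Exchanging the entries at \<open>p\<close> and \<open>q\<close> keeps the class
in both permutations; it goes up in the one that has the value at \<open>p\<close> and down in the other
(\<open>first_divergence_steps\<close>). Hence of two members one always has a step up inside the class and
one always has a step down, so only one member, the longest, has no step up, and every other member
climbs to it; dually for the shortest member (\<open>odd_diagram_class_bounds\<close>).

For the second fact, place the values \<open>1, 2, \<dots>\<close> one after the other and look at the increasing
sequence of places that are still free. Column \<open>j\<close> of the odd diagram is the set of free
places to the left of the place of \<open>j\<close> and of the other parity. Equal columns force \<open>j\<close> into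
the same run, a run being a maximal block of consecutive free places of one parity; so the
parity pattern of the free sequence stays the same throughout a class
(\<open>odd_diagram_eq_imp_same_run\<close>). The Bruhat order implies inequalities between the free sequences,
so for \<open>u \<le> w \<le> v\<close> the free sequence of \<open>w\<close> is squeezed between those of \<open>v\<close> and
\<open>u\<close>. Sequences that are obtained by deletions from the same runs are interlaced: an entry of one of
them is smaller than any later entry of the other that has a different parity. Interlacing
and the inequalities after the next deletion force \<open>w\<close> to delete from the same run as \<open>u\<close>
and \<open>v\<close> (\<open>same_run_squeeze\<close>), and the places that form the column, on which \<open>u\<close> and
\<open>v\<close> agree, are squeezed to the same places in \<open>w\<close> (\<open>opposite_before_squeeze\<close>).
Column by column, \<open>w\<close> gets the same odd diagram.\<close>

section \<open>Transpositions and the Bruhat order\<close>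

text \<open>Applying the transposition to both ends of an inversion, and leaving the inversion alone when this
would reverse its order, is an involution. It carries the inversions of \<open>w\<close> to inversions of the
other permutation and never reaches the new inversion \<open>(a, b)\<close>.\<close>

lemma perm_length_less_swap:
  assumes w: "w permutes {1..n}" and ab: "a \<in> {1..n}" "b \<in> {1..n}" "a < b" and less: "w a < w b"
  shows "perm_length n w < perm_length n (w \<circ> transpose a b)"
proof -
  let ?\<tau> = "transpose a b"
  define I where "I u = {(i, j). i \<in> {1..n} \<and> j \<in> {1..n} \<and> i < j \<and> u i > u j}" for u :: "nat \<Rightarrow> nat"
  have finI: "finite (I u)" for u
    by (rule finite_subset[of _ "{1..n} \<times> {1..n}"]) (auto simp: I_def)
  define f where "f = (\<lambda>(i, j). if ?\<tau> i < ?\<tau> j then (?\<tau> i, ?\<tau> j) else (i, j))"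
  have f_inv: "f (f p) = p" if "p \<in> I u" for p u
    using that by (auto simp: f_def I_def split: if_splits)
  have inj: "inj_on f (I w)"
    by (rule inj_on_inverseI[where g = f]) (rule f_inv)
  have \<tau>_in: "?\<tau> i \<in> {1..n}" if "i \<in> {1..n}" for i
    using that ab by (auto simp: transpose_def)
  have sub: "f ` I w \<subseteq> I (w \<circ> ?\<tau>) - {(a, b)}"
  proof
    fix p assume "p \<in> f ` I w"
    then obtain i j where p: "p = f (i, j)" and ij: "i \<in> {1..n}" "j \<in> {1..n}" "i < j" "w i > w j"
      by (auto simp: I_def)
    show "p \<in> I (w \<circ> ?\<tau>) - {(a, b)}"
    proof (cases "?\<tau> i < ?\<tau> j")
      case True
      have "\<not> (?\<tau> i = a \<and> ?\<tau> j = b)"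
        using ij ab by (auto simp: transpose_def split: if_splits)
      with True show ?thesis
        using ij \<tau>_in[of i] \<tau>_in[of j] by (auto simp: p f_def I_def)
    next
      case False
      then have "(w \<circ> ?\<tau>) i > (w \<circ> ?\<tau>) j \<and> (i, j) \<noteq> (a, b)"
        using ij ab less by (auto simp: transpose_def split: if_splits)
      with False show ?thesis
        using ij by (auto simp: p f_def I_def)
    qed
  qed
  have "(a, b) \<in> I (w \<circ> ?\<tau>)"
    using ab less by (auto simp: I_def)
  then have "f ` I w \<subset> I (w \<circ> ?\<tau>)"
    using sub by blast
  then have "card (f ` I w) < card (I (w \<circ> ?\<tau>))"
    by (rule psubset_card_mono[OF finI])
  then show ?thesis
    using card_image[OF inj] by (simp add: perm_length_def I_def)
qed

lemma bruhat_step_swap: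
  assumes w: "w permutes {1..n}" and ab: "a \<in> {1..n}" "b \<in> {1..n}" "a < b" and less: "w a < w b"
  shows "bruhat_step n w (w \<circ> transpose a b)"
proof -
  have "bij w"
    using w by (rule permutes_bij)
  then have "w \<circ> transpose a b = transpose (w a) (w b) \<circ> w"
    by (simp add: transpose_comp_eq bij_is_inj)
  then have "(w \<circ> transpose a b) \<circ> inv w = transpose (w a) (w b)"
    by (simp add: comp_assoc permutes_inv_o(1)[OF w])
  moreover have "w a \<in> {1..n}" "w b \<in> {1..n}"
    using ab permutes_in_image[OF w] by auto
  moreover have "w \<circ> transpose a b permutes {1..n}"
    using w ab by (intro permutes_compose permutes_swap_id)
  ultimately show ?thesis
    unfolding bruhat_step_def using w less perm_length_less_swap[OF w ab less]
    by (intro conjI bexI[of _ "w a"] bexI[of _ "w b"]) auto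
qed

text \<open>The entrywise comparison of rank matrices, which is the tableau criterion for the Bruhat order. Only
its easy half, that the Bruhat order implies it, enters the proof.\<close>

definition rank_le :: "(nat \<Rightarrow> nat) \<Rightarrow> (nat \<Rightarrow> nat) \<Rightarrow> bool" where
  "rank_le u v \<longleftrightarrow> (\<forall>p j. card {k. k \<le> p \<and> j < u k} \<le> card {k. k \<le> p \<and> j < v k})"

lemma rank_le_swap:
  fixes u :: "nat \<Rightarrow> nat"
  assumes ab: "a < b" and less: "u a < u b"
  shows "rank_le u (u \<circ> transpose a b)"
  unfolding rank_le_def
proof (intro allI)
  fix p j
  let ?\<tau> = "transpose a b"
  show "card {k. k \<le> p \<and> j < u k} \<le> card {k. k \<le> p \<and> j < (u \<circ> ?\<tau>) k}"
  proof (cases "b \<le> p")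
    case True
    have "inj_on ?\<tau> {k. k \<le> p \<and> j < u k}"
      by simp
    moreover have "?\<tau> ` {k. k \<le> p \<and> j < u k} \<subseteq> {k. k \<le> p \<and> j < (u \<circ> ?\<tau>) k}"
      using True ab by (auto simp: transpose_def)
    ultimately show ?thesis
      by (intro card_inj_on_le[of ?\<tau>]) auto
  next
    case False
    then have "{k. k \<le> p \<and> j < u k} \<subseteq> {k. k \<le> p \<and> j < (u \<circ> ?\<tau>) k}"
      using ab less by (auto simp: transpose_def)
    then show ?thesis
      by (intro card_mono) auto
  qed
qed

text \<open>A step exchanges two values, whereas ranks are easiest to follow when two places are exchanged. Since
the length goes up, the smaller value must have been at the left place.\<close>

lemma bruhat_step_imp_rank_le:
  assumes "bruhat_step n u v"
  shows "rank_le u v"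
proof -
  from assms obtain x y where u: "u permutes {1..n}" and v: "v permutes {1..n}"
    and xy: "x \<in> {1..n}" "y \<in> {1..n}" "x \<noteq> y" and eq: "v \<circ> inv u = transpose x y"
    and len: "perm_length n u < perm_length n v"
    unfolding bruhat_step_def by blast
  define a b where "a = min (inv u x) (inv u y)" and "b = max (inv u x) (inv u y)"
  have bij: "bij u"
    using u by (rule permutes_bij)
  have "v = (v \<circ> inv u) \<circ> u"
    using bij by (simp add: comp_assoc bij_is_inj)
  also have "\<dots> = transpose x y \<circ> u"
    by (simp only: eq)
  also have "\<dots> = u \<circ> transpose (inv u x) (inv u y)"
    by (rule transpose_comp_eq[OF bij])
  also have "\<dots> = u \<circ> transpose a b"
    by (auto simp: a_def b_def min_def max_def transpose_commute)
  finally have v_eq: "v = u \<circ> transpose a b" .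
  have "inv u x \<noteq> inv u y"
    using xy bij by (metis bij_inv_eq_iff)
  then have ab: "a < b"
    by (auto simp: a_def b_def)
  have in_n: "a \<in> {1..n}" "b \<in> {1..n}"
    using xy permutes_in_image[OF permutes_inv[OF u]] by (auto simp: a_def b_def min_def max_def)
  have "\<not> u b < u a"
  proof
    assume "u b < u a"
    then have "v a < v b"
      by (simp add: v_eq)
    from perm_length_less_swap[OF v in_n ab this] have "perm_length n v < perm_length n u"
      unfolding v_eq comp_assoc transpose_comp_involutory comp_id .
    with len show False
      by simp
  qed
  moreover have "u a \<noteq> u b"
    using ab bij by (metis bij_pointE less_irrefl)
  ultimately show ?thesis
    unfolding v_eq using ab by (intro rank_le_swap) auto
qed

lemma bruhat_le_imp_rank_le:
  assumes "bruhat_le n u v"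
  shows "rank_le u v"
proof -
  have "(bruhat_step n)\<^sup>*\<^sup>* u v"
    using assms by (simp add: bruhat_le_def)
  then show ?thesis
  proof induction
    case base
    show ?case by (simp add: rank_le_def)
  next
    case (step v w)
    then show ?case
      using bruhat_step_imp_rank_le[OF step.hyps(2)] unfolding rank_le_def
      by (meson le_trans)
  qed
qed


section \<open>Steps inside an odd diagram class\<close>

text \<open>A permutation fixes all points outside \<open>{1..n}\<close>, so the two inequalities already keep the cell
inside the square, and later arguments need no range conditions.\<close>

lemma odd_diagram_iff:
  assumes w: "w permutes {1..n}"
  shows "(i, j) \<in> odd_diagram n w \<longleftrightarrow> i < inv w j \<and> j < w i \<and> even i \<noteq> even (inv w j)"
proof -
  have "i \<in> {1..n} \<and> j \<in> {1..n}" if "i < inv w j" "j < w i"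
  proof -
    have "j \<in> {1..n}"
    proof (rule ccontr)
      assume "j \<notin> {1..n}"
      then have "inv w j = j"
        using permutes_inv[OF w] by (auto simp: permutes_def)
      with that have "i \<in> {1..n}"
        using w by (auto simp: permutes_def)
      then have "w i \<in> {1..n}"
        using permutes_in_image[OF w] by blast
      with \<open>j \<notin> {1..n}\<close> \<open>inv w j = j\<close> that show False
        by auto
    qed
    moreover from this have "inv w j \<in> {1..n}"
      using permutes_in_image[OF permutes_inv[OF w]] by blast
    moreover have "i \<noteq> 0"
      using that w by (metis permutes_not_in atLeastAtMost_iff not_less_zero not_one_le_zero)
    ultimately show ?thesis
      using that by auto
  qed
  then show ?thesis
    unfolding odd_diagram_def diagram_def by (auto simp: even_iff_mod_2_eq_zero)
qed

text \<open>The entries at \<open>a\<close> and \<open>b\<close> have places of equal parity, so no cell of the odd diagram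
relates them to each other. Each hypothesis on a place \<open>k\<close> of the other parity says that
\<open>k\<close> cannot tell which of the two entries comes first: in between, its entry is too small to
produce a cell in the columns \<open>w a\<close> and \<open>w b\<close>, and further right its entry compares in the
same way with both.\<close>

lemma odd_diagram_swap:
  assumes w: "w permutes {1..n}" and ab: "a \<in> {1..n}" "b \<in> {1..n}" "a < b"
    and less: "w a < w b" and par: "even a = even b"
    and between: "\<And>k. a < k \<Longrightarrow> k < b \<Longrightarrow> even k \<noteq> even a \<Longrightarrow> w k < w a"
    and after: "\<And>k. b < k \<Longrightarrow> even k \<noteq> even a \<Longrightarrow> \<not> (w a < w k \<and> w k < w b)"
  shows "odd_diagram n (w \<circ> transpose a b) = odd_diagram n w"
proof -
  let ?v = "w \<circ> transpose a b"
  have v: "?v permutes {1..n}"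
    using w ab by (intro permutes_compose permutes_swap_id)
  have inj: "w i = w k \<longleftrightarrow> i = k" for i k
    using permutes_inj[OF w] by (auto dest: injD)
  have "(i, j) \<in> odd_diagram n ?v \<longleftrightarrow> (i, j) \<in> odd_diagram n w" for i j
  proof -
    obtain k where k: "j = w k"
      using permutes_surj[OF w] by (metis surjD)
    have ik: "inv w j = k"
      unfolding k using permutes_inverses(2)[OF w] by simp
    have "?v (transpose a b k) = j"
      by (simp add: k)
    then have ivk: "inv ?v j = transpose a b k"
      using permutes_inverses(2)[OF v] by metis
    have "i < transpose a b k \<and> w k < w (transpose a b i) \<and> even i \<noteq> even (transpose a b k) \<longleftrightarrow>
          i < k \<and> w k < w i \<and> even i \<noteq> even k"
    proof (cases "even i = even a")
      case True
      show ?thesis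
      proof (cases "even k = even a")
        case True
        with \<open>even i = even a\<close> par show ?thesis
          by (auto simp: transpose_def)
      next
        case False
        then have "k \<noteq> a" "k \<noteq> b"
          using par by auto
        then consider "k < a" | "a < k" "k < b" | "b < k"
          by linarith
        then show ?thesis
        proof cases
          case 1
          with ab show ?thesis
            by (auto simp: transpose_def)
        next
          case 2
          with False True ab less between[of k] show ?thesis
            by (auto simp: transpose_def)
        next
          case 3
          with False True ab less after[of k] inj[of k a] inj[of k b] show ?thesis
            by (auto simp: transpose_def)
        qed
      qed
    next
      case False
      then have "i \<noteq> a" "i \<noteq> b"
        using par by auto
      then consider "i < a" | "a < i" "i < b" | "b < i"
        by linarith
      then show ?thesis
      proof cases
        case 2
        with False ab less between[of i] show ?thesis
          by (auto simp: transpose_def)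
      qed (use ab par in \<open>auto simp: transpose_def\<close>)
    qed
    then show ?thesis
      unfolding odd_diagram_iff[OF w] odd_diagram_iff[OF v] ik ivk by (simp add: k)
  qed
  then show ?thesis
    by auto
qed

text \<open>Let \<open>p < q\<close> be the places of \<open>j\<close> in \<open>w\<close> and in \<open>v\<close>. Column \<open>j\<close> forces
\<open>p\<close> and \<open>q\<close> to have equal parity and all entries between them at places of the other parity to be
smaller than \<open>j\<close>. A place \<open>k > q\<close> of the other parity whose entry lies strictly between
the two exchanged ones would give a cell in row \<open>q\<close> for \<open>w\<close>, or row \<open>p\<close> for \<open>v\<close>, that
the other permutation lacks because it has \<open>j\<close> there. These are the hypotheses of
\<open>odd_diagram_swap\<close>.\<close>

lemma first_divergence_steps:
  assumes w: "w permutes {1..n}" and v: "v permutes {1..n}"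
    and eq: "odd_diagram n w = odd_diagram n v"
    and same: "\<And>i. i < j \<Longrightarrow> inv w i = inv v i" and less: "inv w j < inv v j"
  defines "\<tau> \<equiv> transpose (inv w j) (inv v j)"
  shows "bruhat_step n w (w \<circ> \<tau>) \<and> odd_diagram n (w \<circ> \<tau>) = odd_diagram n w"
    and "bruhat_step n (v \<circ> \<tau>) v \<and> odd_diagram n (v \<circ> \<tau>) = odd_diagram n v"
proof -
  define p q where "p = inv w j" and "q = inv v j"
  have pq: "p < q"
    using less by (simp add: p_def q_def)
  note iw = permutes_inverses[OF w] and iv = permutes_inverses[OF v]
  have wp: "w p = j" and vq: "v q = j"
    by (simp_all add: p_def q_def iw iv)
  have j: "j \<in> {1..n}"
    using less permutes_inv[OF w] permutes_inv[OF v] by (metis less_irrefl permutes_not_in)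
  have p: "p \<in> {1..n}" and q: "q \<in> {1..n}"
    using j permutes_in_image[OF permutes_inv[OF w]] permutes_in_image[OF permutes_inv[OF v]]
    by (auto simp: p_def q_def)
  have dia: "k < inv w t \<and> t < w k \<and> even k \<noteq> even (inv w t) \<longleftrightarrow>
             k < inv v t \<and> t < v k \<and> even k \<noteq> even (inv v t)" for k t
    using eq odd_diagram_iff[OF w, of k t] odd_diagram_iff[OF v, of k t] by simp
  have small: "w k = v k" if "w k < j \<or> v k < j" for k
    using that same iw iv by metis
  have vp: "j < v p"
    using small[of p] wp vq pq by (metis less_irrefl linorder_neqE_nat iv(2))
  have wq: "j < w q"
    using small[of q] wp vq pq by (metis less_irrefl linorder_neqE_nat iw(2))
  have par: "even p = even q"
    using dia[of p j] vp pq by (auto simp: p_def[symmetric] q_def[symmetric])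
  have between: "v k < j" "w k < j" if "p < k" "k < q" "even k \<noteq> even p" for k
  proof -
    have "\<not> j < v k"
      using dia[of k j] that par by (auto simp: p_def[symmetric] q_def[symmetric])
    moreover have "v k \<noteq> j"
      using that vq by (metis iv(2) less_irrefl)
    ultimately show "v k < j" by simp
    then show "w k < j"
      using small[of k] by simp
  qed
  have after_w: "\<not> (j < w k \<and> w k < w q)" if "q < k" "even k \<noteq> even p" for k
    using dia[of q "w k"] that par vq by (auto simp: iw)
  have after_v: "\<not> (j < v k \<and> v k < v p)" if "q < k" "even k \<noteq> even p" for k
    using dia[of p "v k"] that pq wp by (auto simp: iv)
  have \<tau>: "\<tau> = transpose p q"
    by (simp add: \<tau>_def p_def q_def)
  show "bruhat_step n w (w \<circ> \<tau>) \<and> odd_diagram n (w \<circ> \<tau>) = odd_diagram n w"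
    unfolding \<tau> using wp wq pq p q par between after_w w
    by (intro conjI bruhat_step_swap odd_diagram_swap) auto
  \<comment> \<open>For the step down, apply the exchange criterion to the lower permutation, which returns \<open>v\<close>.\<close>
  let ?v = "v \<circ> transpose p q"
  have v': "?v permutes {1..n}"
    using v p q by (intro permutes_compose permutes_swap_id)
  have undo: "?v \<circ> transpose p q = v"
    by (simp add: comp_assoc)
  have ends: "?v p = j" "?v q = v p"
    by (simp_all add: vq)
  have other: "?v k = v k" if "even k \<noteq> even p" for k
    using that par by (metis comp_apply transpose_apply_other)
  have "bruhat_step n ?v (?v \<circ> transpose p q)"
    using ends vp by (intro bruhat_step_swap v' p q pq) simp
  moreover have "odd_diagram n (?v \<circ> transpose p q) = odd_diagram n ?v"
  proof (intro odd_diagram_swap v' p q pq par)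
    show "?v p < ?v q"
      using vp by (simp only: ends)
    show "?v k < ?v p" if "p < k" "k < q" "even k \<noteq> even p" for k
      using between(1)[OF that] by (simp only: ends other[OF that(3)])
    show "\<not> (?v p < ?v k \<and> ?v k < ?v q)" if "q < k" "even k \<noteq> even p" for k
      using after_v[OF that] by (simp only: ends other[OF that(2)] not_False_eq_True)
  qed
  ultimately show "bruhat_step n (v \<circ> \<tau>) v \<and> odd_diagram n (v \<circ> \<tau>) = odd_diagram n v"
    unfolding \<tau> undo by simp
qed

lemma odd_diagram_class_steps:
  assumes w: "w permutes {1..n}" and v: "v permutes {1..n}"
    and eq: "odd_diagram n w = odd_diagram n v" and neq: "w \<noteq> v"
  shows "(\<exists>w'. bruhat_step n w w' \<and> odd_diagram n w' = odd_diagram n w) \<and>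
         (\<exists>v'. bruhat_step n v' v \<and> odd_diagram n v' = odd_diagram n v) \<or>
         (\<exists>w'. bruhat_step n w' w \<and> odd_diagram n w' = odd_diagram n w) \<and>
         (\<exists>v'. bruhat_step n v v' \<and> odd_diagram n v' = odd_diagram n v)"
proof -
  have "\<exists>j. inv w j \<noteq> inv v j"
    using neq w v by (metis permutes_inv_inv ext)
  then obtain j where j: "inv w j \<noteq> inv v j" and same: "\<And>i. i < j \<Longrightarrow> inv w i = inv v i"
    using exists_least_iff[of "\<lambda>j. inv w j \<noteq> inv v j"] by blast
  show ?thesis
  proof (cases "inv w j < inv v j")
    case True
    from first_divergence_steps[OF w v eq same this] show ?thesis by blast
  next
    case False
    then have "inv v j < inv w j"
      using j by simp
    from first_divergence_steps[OF v w eq[symmetric] same[symmetric] this] show ?thesis by blast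
  qed
qed

text \<open>A longest member of the class has no step up within it, so every other member has one, and
iterating these steps can only end at that longest member. The same holds downwards.\<close>

lemma odd_diagram_class_bounds:
  assumes "\<exists>w. w permutes {1..n} \<and> odd_diagram n w = D"
  obtains u v where "u permutes {1..n}" "odd_diagram n u = D" "v permutes {1..n}" "odd_diagram n v = D"
    and "\<And>w. w permutes {1..n} \<Longrightarrow> odd_diagram n w = D \<Longrightarrow> bruhat_le n u w \<and> bruhat_le n w v"
proof -
  define C where "C = {w. w permutes {1..n} \<and> odd_diagram n w = D}"
  have fin: "finite C"
    unfolding C_def by (rule finite_subset[OF _ finite_permutations[of "{1..n}"]]) auto
  have ne: "C \<noteq> {}"
    using assms by (auto simp: C_def)
  have fl: "finite (perm_length n ` C)" "perm_length n ` C \<noteq> {}"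
    using fin ne by auto
  obtain v where v: "v \<in> C" "perm_length n v = Max (perm_length n ` C)"
    using Max_in[OF fl] by (metis imageE)
  obtain u where u: "u \<in> C" "perm_length n u = Min (perm_length n ` C)"
    using Min_in[OF fl] by (metis imageE)
  have v_max: "perm_length n w \<le> perm_length n v" if "w \<in> C" for w
    using that fin v(2) by simp
  have u_min: "perm_length n u \<le> perm_length n w" if "w \<in> C" for w
    using that fin u(2) by simp
  have step_D: "x \<in> C \<and> y \<in> C \<and> perm_length n x < perm_length n y"
    if "bruhat_step n x y" "odd_diagram n x = D" "odd_diagram n y = D" for x y
    using that by (auto simp: C_def bruhat_step_def)
  have up: "\<exists>w'\<in>C. bruhat_step n w w'" if "w \<in> C" "w \<noteq> v" for w
  proof -
    have "\<not> (\<exists>v'. bruhat_step n v v' \<and> odd_diagram n v' = odd_diagram n v)"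
      using v(1) v_max step_D[of v] by (metis (mono_tags, lifting) C_def mem_Collect_eq not_le)
    then show ?thesis
      using odd_diagram_class_steps[of w n v] that v(1) step_D[of w] by (auto simp: C_def)
  qed
  have down: "\<exists>w'\<in>C. bruhat_step n w' w" if "w \<in> C" "w \<noteq> u" for w
  proof -
    have "\<not> (\<exists>u'. bruhat_step n u' u \<and> odd_diagram n u' = odd_diagram n u)"
      using u(1) u_min step_D[of _ u] by (metis (mono_tags, lifting) C_def mem_Collect_eq not_le)
    then show ?thesis
      using odd_diagram_class_steps[of w n u] that u(1) step_D[of _ w] by (auto simp: C_def)
  qed
  have "(bruhat_step n)\<^sup>*\<^sup>* w v" if "w \<in> C" for w
    using that
  proof (induction "perm_length n v - perm_length n w" arbitrary: w rule: less_induct)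
    case less
    show ?case
    proof (cases "w = v")
      case False
      then obtain w' where w': "w' \<in> C" "bruhat_step n w w'"
        using up less.prems by blast
      then have "(bruhat_step n)\<^sup>*\<^sup>* w' v"
        using v_max[of w'] by (intro less.hyps) (auto simp: bruhat_step_def)
      with w'(2) show ?thesis
        by (rule converse_rtranclp_into_rtranclp)
    qed simp
  qed
  moreover have "(bruhat_step n)\<^sup>*\<^sup>* u w" if "w \<in> C" for w
    using that
  proof (induction "perm_length n w" arbitrary: w rule: less_induct)
    case less
    show ?case
    proof (cases "w = u")
      case False
      then obtain w' where w': "w' \<in> C" "bruhat_step n w' w"
        using down less.prems by blast
      then have "(bruhat_step n)\<^sup>*\<^sup>* u w'"
        by (intro less.hyps) (auto simp: bruhat_step_def)
      then show ?thesis
        using w'(2) by simp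
    qed simp
  qed
  ultimately have "bruhat_le n u w \<and> bruhat_le n w v"
    if "w permutes {1..n}" "odd_diagram n w = D" for w
    using that u(1) v(1) by (simp add: bruhat_le_def C_def)
  then show ?thesis
    using u(1) v(1) by (intro that[of u v]) (simp_all add: C_def)
qed


section \<open>Increasing sequences with prescribed parities\<close>

text \<open>The sequences below stand for the free places of a permutation in increasing order. They are
infinite, because the points beyond \<open>n\<close> are kept; this removes all bounds on the indices.\<close>

definition delete_nth :: "nat \<Rightarrow> (nat \<Rightarrow> nat) \<Rightarrow> nat \<Rightarrow> nat" where
  "delete_nth t g i = (if i < t then g i else g (Suc i))"

definition same_parities :: "(nat \<Rightarrow> nat) \<Rightarrow> (nat \<Rightarrow> nat) \<Rightarrow> bool" where
  "same_parities g h \<longleftrightarrow> (\<forall>i. even (g i) = even (h i))"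

definition same_run :: "(nat \<Rightarrow> nat) \<Rightarrow> nat \<Rightarrow> nat \<Rightarrow> bool" where
  "same_run g s t \<longleftrightarrow> (\<forall>i. min s t \<le> i \<and> i \<le> max s t \<longrightarrow> even (g i) = even (g s))"

text \<open>For sequences with the same parities this says that neither one can carry an entry past the
boundary between two runs of the other.\<close>

definition interlaced :: "(nat \<Rightarrow> nat) \<Rightarrow> (nat \<Rightarrow> nat) \<Rightarrow> bool" where
  "interlaced g h \<longleftrightarrow> (\<forall>i j. i < j \<and> even (g i) \<noteq> even (g j) \<longrightarrow> g i < h j \<and> h i < g j)"

definition opposite_before :: "(nat \<Rightarrow> nat) \<Rightarrow> nat \<Rightarrow> nat set" where
  "opposite_before g t = g ` {i. i < t \<and> even (g i) \<noteq> even (g t)}"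

lemma same_run_parity: "same_run g s t \<Longrightarrow> min s t \<le> i \<Longrightarrow> i \<le> max s t \<Longrightarrow> even (g i) = even (g s)"
  unfolding same_run_def by blast

lemma same_run_cong: "same_parities g h \<Longrightarrow> same_run g s t \<longleftrightarrow> same_run h s t"
  unfolding same_run_def same_parities_def by simp

text \<open>Deleting at \<open>s\<close> or at \<open>t\<close> differs only at the indices between them, where neighbouring
entries have equal parity.\<close>

lemma same_parities_delete:
  assumes par: "same_parities g h" and run: "same_run g s t"
  shows "same_parities (delete_nth s g) (delete_nth t h)"
  unfolding same_parities_def
proof
  fix i
  have par': "even (g i) = even (h i)" for i
    using par by (simp add: same_parities_def)
  have "even (g i) = even (g (Suc i))" if "min s t \<le> i" "i < max s t"
    using same_run_parity[OF run, of i] same_run_parity[OF run, of "Suc i"] that by simp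
  then show "even (delete_nth s g i) = even (delete_nth t h i)"
    by (auto simp: delete_nth_def par' min_def max_def split: if_splits)
qed

text \<open>The entries at \<open>i\<close> and \<open>j\<close> after the deletions come from the indices \<open>i\<close> or
\<open>i + 1\<close> and \<open>j\<close> or \<open>j + 1\<close>. The only way to lose the order is that both come from
the same index, which the different parities exclude.\<close>

lemma interlaced_delete:
  assumes par: "same_parities g h" and lac: "interlaced g h" and run: "same_run g s t"
  shows "interlaced (delete_nth s g) (delete_nth t h)"
  unfolding interlaced_def
proof (intro allI impI)
  fix i j
  assume ij: "i < j \<and> even (delete_nth s g i) \<noteq> even (delete_nth s g j)"
  define G H where "G i = (if i < s then i else Suc i)" and "H i = (if i < t then i else Suc i)" for i
  have del: "delete_nth s g i = g (G i)" "delete_nth t h i = h (H i)" for i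
    by (simp_all add: delete_nth_def G_def H_def)
  have par': "even (g i) = even (h i)" for i
    using par by (simp add: same_parities_def)
  have GH: "even (g (G i)) = even (g (H i))" for i
    using same_parities_delete[OF par run] by (simp add: same_parities_def del par')
  have "G i \<noteq> H j" "H i \<noteq> G j"
    using ij by (metis del(1) GH)+
  then have "G i < H j" "H i < G j"
    using ij by (auto simp: G_def H_def split: if_splits)
  moreover have "even (g (G i)) \<noteq> even (g (H j))" "even (g (H i)) \<noteq> even (g (G j))"
    using ij del(1)[of i] del(1)[of j] GH[of i] GH[of j] by simp_all
  ultimately have "g (G i) < h (H j)" "h (H i) < g (G j)"
    using lac unfolding interlaced_def by blast+
  then show "delete_nth s g i < delete_nth t h j \<and> delete_nth t h i < delete_nth s g j"
    by (simp add: del)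
qed

lemma same_run_of_no_change:
  assumes "s \<le> t" and "\<And>i. s \<le> i \<Longrightarrow> i < t \<Longrightarrow> even (g i) = even (g (Suc i))"
  shows "same_run g s t"
proof -
  have "s + d \<le> t \<Longrightarrow> even (g (s + d)) = even (g s)" for d
    using assms(2) by (induction d) (auto)
  then show ?thesis
    using assms(1) unfolding same_run_def by (metis le_add_diff_inverse min.absorb1 max.absorb2)
qed

lemma same_run_sym: "same_run g s t \<Longrightarrow> same_run g t s"
  unfolding same_run_def by (metis max.cobounded1 min.cobounded1 min.commute max.commute)

lemma same_run_mono:
  "same_run g s t \<Longrightarrow> min s t \<le> r \<Longrightarrow> r \<le> max s t \<Longrightarrow> same_run g s r"
  unfolding same_run_def by (meson le_trans max.boundedI max.cobounded1 min.boundedI min.cobounded1)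

lemma same_run_trans:
  assumes "same_run g r s" "same_run g s t"
  shows "same_run g r t"
proof -
  have rs: "even (g s) = even (g r)"
    using assms(1) by (rule same_run_parity) auto
  have "even (g i) = even (g r)" if "min r t \<le> i" "i \<le> max r t" for i
  proof (cases "min r s \<le> i \<and> i \<le> max r s")
    case True
    then show ?thesis
      using same_run_parity[OF assms(1)] by blast
  next
    case False
    then have "min s t \<le> i \<and> i \<le> max s t"
      using that by (auto simp: min_def max_def split: if_splits)
    then show ?thesis
      using same_run_parity[OF assms(2)] rs by blast
  qed
  then show ?thesis
    unfolding same_run_def by blast
qed

text \<open>If \<open>s < t\<close> and the entries there had different parities, then \<open>h s\<close> would lie in the second
set, whereas all members of the first one differ in parity from \<open>g s\<close> and \<open>h s\<close>. With equal
parities, counting shows that no entry of the opposite parity has an index between \<open>s\<close> and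
\<open>t\<close>.\<close>

lemma same_run_of_opposite_before_eq:
  assumes mono: "strict_mono g" "strict_mono h" and par: "same_parities g h"
    and eq: "opposite_before g s = opposite_before h t"
  shows "same_run g s t"
proof -
  have *: "same_run g s t" if mono: "strict_mono g" "strict_mono h" and par: "\<And>i. even (g i) = even (h i)"
    and eq: "opposite_before g s = opposite_before h t" and st: "s \<le> t" for g h s t
  proof -
    have ts: "even (g t) = even (g s)"
    proof (rule ccontr)
      assume neq: "even (g t) \<noteq> even (g s)"
      then have "h s \<in> opposite_before h t"
        using st by (auto simp: opposite_before_def par order_less_le)
      then have "h s \<in> opposite_before g s"
        using eq by simp
      then show False
        by (auto simp: opposite_before_def par)
    qed
    let ?A = "{i. i < s \<and> even (g i) \<noteq> even (g s)}" and ?B = "{i. i < t \<and> even (g i) \<noteq> even (g s)}"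
    have "card ?A = card (opposite_before g s)"
      unfolding opposite_before_def using mono(1)
      by (intro card_image[symmetric]) (auto intro: strict_mono_imp_inj_on)
    also have "\<dots> = card (opposite_before h t)"
      by (simp only: eq)
    also have "opposite_before h t = h ` ?B"
      using ts by (simp add: opposite_before_def par)
    also have "card (h ` ?B) = card ?B"
      using mono(2) by (intro card_image) (auto intro: strict_mono_imp_inj_on)
    finally have AB: "?A = ?B"
      using st by (intro card_subset_eq) auto
    have "even (g i) = even (g s)" if "s \<le> i" "i < t" for i
    proof -
      have "i \<in> ?A \<longleftrightarrow> i \<in> ?B"
        by (simp only: AB)
      with that show ?thesis by simp
    qed
    then show ?thesis
      unfolding same_run_def using st ts
      by (metis le_neq_implies_less max.absorb2 min.absorb1)
  qed
  have par': "even (g i) = even (h i)" for i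
    using par by (simp add: same_parities_def)
  show ?thesis
  proof (cases "s \<le> t")
    case True
    with * mono par' eq show ?thesis by blast
  next
    case False
    then have "same_run h t s"
      using *[of h g t s] mono par' eq by simp
    then have "same_run h s t"
      by (rule same_run_sym)
    then show ?thesis
      using same_run_cong[OF par] by blast
  qed
qed

text \<open>Suppose that \<open>g\<close> deletes further left than \<open>f\<close> and that the parity changes from \<open>i\<close> to
\<open>Suc i\<close> in between. After the deletions the entries with index \<open>i\<close> are \<open>g (Suc i)\<close> and
\<open>f i\<close>; the upper bound asks for \<open>g (Suc i) \<le> f i\<close>, against interlacing. In the same way the
lower bound \<open>h\<close> prevents a deletion in a later run.\<close>

lemma same_run_squeeze:
  assumes par: "same_parities f g" "same_parities g h"
    and lac: "interlaced f g" "interlaced g h"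
    and run: "same_run g r t"
    and le: "\<And>i. delete_nth s g i \<le> delete_nth r f i" "\<And>i. delete_nth t h i \<le> delete_nth s g i"
  shows "same_run g r s"
proof -
  have par': "even (f i) = even (g i)" "even (h i) = even (g i)" for i
    using par by (simp_all add: same_parities_def)
  have left: "same_run g s r" if "s < r"
  proof (rule same_run_of_no_change)
    fix i assume i: "s \<le> i" "i < r"
    show "even (g i) = even (g (Suc i))"
    proof (rule ccontr)
      assume "even (g i) \<noteq> even (g (Suc i))"
      then have "f i < g (Suc i)"
        using lac(1) par' unfolding interlaced_def by blast
      then show False
        using le(1)[of i] i by (simp add: delete_nth_def)
    qed
  qed (use that in simp)
  have right: "same_run g t s" if "t < s"
  proof (rule same_run_of_no_change)
    fix i assume i: "t \<le> i" "i < s"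
    show "even (g i) = even (g (Suc i))"
    proof (rule ccontr)
      assume "even (g i) \<noteq> even (g (Suc i))"
      then have "g i < h (Suc i)"
        using lac(2) unfolding interlaced_def by blast
      then show False
        using le(2)[of i] i by (simp add: delete_nth_def)
    qed
  qed (use that in simp)
  show ?thesis
  proof (cases "s < r")
    case True
    then show ?thesis
      using same_run_sym[OF left] by simp
  next
    case False
    show ?thesis
    proof (cases "t < s")
      case True
      then show ?thesis
        using same_run_trans[OF run right] by simp
    next
      case False
      then show ?thesis
        using \<open>\<not> s < r\<close> run by (intro same_run_mono[OF run]) auto
    qed
  qed
qed

text \<open>Entries of the opposite parity are either before or after the whole run, so any index of the run
may serve as the boundary.\<close>

lemma opposite_before_same_run:
  assumes par: "same_parities f g" and run: "same_run g r s"
  shows "opposite_before f r = f ` {i. i < s \<and> even (g i) \<noteq> even (g s)}"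
proof -
  have par': "even (f i) = even (g i)" for i
    using par by (simp add: same_parities_def)
  have rs: "even (g s) = even (g r)"
    using run by (rule same_run_parity) auto
  have "i < r \<longleftrightarrow> i < s" if "even (g i) \<noteq> even (g s)" for i
  proof -
    have "\<not> (min r s \<le> i \<and> i \<le> max r s)"
      using same_run_parity[OF run, of i] that rs by blast
    then show ?thesis by linarith
  qed
  then show ?thesis
    unfolding opposite_before_def par' using rs by metis
qed

text \<open>All three sets are images of one finite index set. The images under \<open>f\<close> and \<open>h\<close> have the same
sum and \<open>h \<le> f\<close> holds pointwise, so \<open>f\<close> and \<open>h\<close> coincide on it, and so does \<open>g\<close>, which
lies between them.\<close>

lemma opposite_before_squeeze:
  assumes mono: "strict_mono f" "strict_mono h"
    and par: "same_parities f g" "same_parities g h"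
    and run: "same_run g r s" "same_run g s t"
    and le: "\<And>i. g i \<le> f i" "\<And>i. h i \<le> g i"
    and eq: "opposite_before f r = opposite_before h t"
  shows "opposite_before g s = opposite_before f r"
proof -
  let ?I = "{i. i < s \<and> even (g i) \<noteq> even (g s)}"
  have f: "opposite_before f r = f ` ?I"
    by (rule opposite_before_same_run[OF par(1) run(1)])
  have "same_parities h g"
    using par(2) by (simp add: same_parities_def)
  from opposite_before_same_run[OF this same_run_sym[OF run(2)]]
  have h: "opposite_before h t = h ` ?I" .
  have inj: "inj_on f ?I" "inj_on h ?I"
    using mono by (auto intro: strict_mono_imp_inj_on)
  have "sum h ?I = sum (\<lambda>x. x) (h ` ?I)"
    using inj(2) by (simp add: sum.reindex)
  also have "h ` ?I = f ` ?I"
    using eq f h by simp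
  also have "sum (\<lambda>x. x) (f ` ?I) = sum f ?I"
    using inj(1) by (simp add: sum.reindex)
  finally have "sum h ?I = sum f ?I" .
  then have "h i = f i" if "i \<in> ?I" for i
    using that le by (intro sum_mono_inv[of h ?I f]) (auto intro: le_trans)
  then have "g i = f i" if "i \<in> ?I" for i
    using that le by (metis le_antisym)
  then show ?thesis
    unfolding f by (simp add: opposite_before_def)
qed


section \<open>Removing the values one by one\<close>

lemma strict_mono_unique:
  fixes g h :: "nat \<Rightarrow> nat"
  assumes g: "strict_mono g" and h: "strict_mono h" and range: "range g = range h"
  shows "g = h"
proof
  fix i
  show "g i = h i"
  proof (induction i rule: less_induct)
    case (less i)
    have "\<not> g i < h i"
    proof
      assume lt: "g i < h i"
      obtain m where m: "g i = h m"
        using range by (metis rangeI imageE)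
      then have "m < i"
        using lt h by (simp add: strict_mono_less)
      with less[of m] m strict_monoD[OF g, of m i] show False
        by simp
    qed
    moreover have "\<not> h i < g i"
    proof
      assume lt: "h i < g i"
      obtain m where m: "h i = g m"
        using range by (metis rangeI imageE)
      then have "m < i"
        using lt g by (simp add: strict_mono_less)
      with less[of m] m strict_monoD[OF h, of m i] show False
        by simp
    qed
    ultimately show ?case by simp
  qed
qed

lemma enumerate_delete:
  fixes S :: "nat set"
  assumes S: "infinite S"
  shows "enumerate (S - {enumerate S t}) = delete_nth t (enumerate S)"
proof (rule strict_mono_unique)
  have S': "infinite (S - {enumerate S t})"
    using S by simp
  then show "strict_mono (enumerate (S - {enumerate S t}))"
    by (rule strict_mono_enumerate)
  show "strict_mono (delete_nth t (enumerate S))"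
    using S by (auto simp: strict_mono_def delete_nth_def)
  have "range (delete_nth t (enumerate S)) = enumerate S ` (UNIV - {t})"
  proof
    show "range (delete_nth t (enumerate S)) \<subseteq> enumerate S ` (UNIV - {t})"
      by (auto simp: delete_nth_def)
    show "enumerate S ` (UNIV - {t}) \<subseteq> range (delete_nth t (enumerate S))"
    proof
      fix x assume "x \<in> enumerate S ` (UNIV - {t})"
      then obtain i where i: "i \<noteq> t" "x = enumerate S i" by auto
      then have "x = delete_nth t (enumerate S) (if i < t then i else i - 1)"
        by (auto simp: delete_nth_def)
      then show "x \<in> range (delete_nth t (enumerate S))" by blast
    qed
  qed
  also have "\<dots> = S - {enumerate S t}"
    using range_enumerate[OF S] inj_enumerate[OF S] by (auto simp: inj_eq)
  finally show "range (enumerate (S - {enumerate S t})) = range (delete_nth t (enumerate S))"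
    using range_enumerate[OF S'] by simp
qed

text \<open>The free places at the time when the values up to \<open>j\<close> have been placed, and the index in this
sequence at which the value \<open>Suc j\<close> is going to be placed.\<close>

definition places_above :: "(nat \<Rightarrow> nat) \<Rightarrow> nat \<Rightarrow> nat \<Rightarrow> nat" where
  "places_above w j = enumerate {k. j < w k}"

definition next_index :: "(nat \<Rightarrow> nat) \<Rightarrow> nat \<Rightarrow> nat" where
  "next_index w j = inv (places_above w j) (inv w (Suc j))"

context
  fixes n :: nat and w :: "nat \<Rightarrow> nat"
  assumes w: "w permutes {1..n}"
begin

lemma infinite_above: "infinite {k. j < w k}"
proof -
  have "{k. j < w k} = UNIV - inv w ` {..j}"
    using permutes_inverses[OF w] by (auto simp: image_iff) (metis atMost_iff not_le)
  then show ?thesis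
    by (simp add: infinite_UNIV_nat Diff_infinite_finite)
qed

lemma strict_mono_places_above: "strict_mono (places_above w j)"
  unfolding places_above_def by (rule strict_mono_enumerate[OF infinite_above])

lemma range_places_above: "range (places_above w j) = {k. j < w k}"
  unfolding places_above_def by (rule range_enumerate[OF infinite_above])

lemma places_above_next_index: "places_above w j (next_index w j) = inv w (Suc j)"
  unfolding next_index_def
  by (rule f_inv_into_f) (simp add: range_places_above permutes_inverses[OF w])

lemma places_above_Suc: "places_above w (Suc j) = delete_nth (next_index w j) (places_above w j)"
proof -
  have "{k. Suc j < w k} = {k. j < w k} - {inv w (Suc j)}"
    using permutes_inverses[OF w] by auto (metis Suc_lessI)
  then show ?thesis
    using enumerate_delete[OF infinite_above, of j "next_index w j"] places_above_next_index[of j]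
    by (simp add: places_above_def)
qed

text \<open>This is the link between the diagram and the free sequences: a cell in column \<open>Suc j\<close> is a free
place to the left of the place of \<open>Suc j\<close>, of the opposite parity.\<close>

lemma odd_diagram_column:
  "{i. (i, Suc j) \<in> odd_diagram n w} = opposite_before (places_above w j) (next_index w j)"
proof -
  have "(i, Suc j) \<in> odd_diagram n w \<longleftrightarrow>
        i < inv w (Suc j) \<and> j < w i \<and> even i \<noteq> even (inv w (Suc j))" for i
    unfolding odd_diagram_iff[OF w] using permutes_inverses[OF w] by (metis Suc_lessD Suc_lessI less_irrefl)
  then have "{i. (i, Suc j) \<in> odd_diagram n w} =
        {i \<in> range (places_above w j). i < inv w (Suc j) \<and> even i \<noteq> even (inv w (Suc j))}"
    unfolding range_places_above by blast
  also have "\<dots> = opposite_before (places_above w j) (next_index w j)"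
    unfolding opposite_before_def places_above_next_index[symmetric]
    by (auto simp: strict_mono_less[OF strict_mono_places_above])
  finally show ?thesis .
qed

lemma card_places_above_le:
  "card {k. k \<le> p \<and> j < w k} = card {i. places_above w j i \<le> p}"
proof -
  have "{k. k \<le> p \<and> j < w k} = places_above w j ` {i. places_above w j i \<le> p}"
    using range_places_above[of j] by (auto simp: image_iff)
  moreover have "inj_on (places_above w j) {i. places_above w j i \<le> p}"
    by (rule strict_mono_imp_inj_on[OF strict_mono_places_above])
  ultimately show ?thesis
    by (simp add: card_image)
qed

lemma places_above_0: "places_above w 0 i = Suc i"
proof -
  have "{k. 0 < w k} = range Suc"
  proof -
    have "0 < w k \<longleftrightarrow> 0 < k" for k
      using permutes_not_in[OF w, of 0] inj_eq[OF permutes_inj[OF w], of k 0] by auto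
    then show ?thesis
      by (simp only:) (auto simp: gr0_conv_Suc)
  qed
  then have "places_above w 0 = Suc"
    using range_places_above[of 0]
    by (intro strict_mono_unique strict_mono_places_above) (auto simp: strict_mono_Suc_iff)
  then show ?thesis by simp
qed

end

text \<open>Having at least as many free places in every initial segment means that each free place, counted
from the left, comes no later.\<close>

lemma rank_le_places_above:
  assumes u: "u permutes {1..n}" and v: "v permutes {1..n}" and le: "rank_le u v"
  shows "places_above v j i \<le> places_above u j i"
proof (rule ccontr)
  let ?p = "places_above u j i"
  assume "\<not> places_above v j i \<le> ?p"
  then have "{m. places_above v j m \<le> ?p} \<subseteq> {..<i}"
    using strict_mono_less_eq[OF strict_mono_places_above[OF v]]
    by (auto simp: not_le) (metis not_le order_trans less_le_not_le)
  then have "card {m. places_above v j m \<le> ?p} \<le> i"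
    using card_mono[of "{..<i}"] by fastforce
  moreover have "{m. places_above u j m \<le> ?p} = {..i}"
    by (auto simp: strict_mono_less_eq[OF strict_mono_places_above[OF u]])
  moreover have "card {m. places_above u j m \<le> ?p} \<le> card {m. places_above v j m \<le> ?p}"
    using le by (simp add: rank_le_def card_places_above_le[OF u, symmetric] card_places_above_le[OF v, symmetric])
  ultimately show False by simp
qed

lemma odd_diagram_eqI:
  assumes w: "w permutes {1..n}" and v: "v permutes {1..n}"
    and "\<And>j. opposite_before (places_above w j) (next_index w j) =
             opposite_before (places_above v j) (next_index v j)"
  shows "odd_diagram n w = odd_diagram n v"
proof -
  have "(i, j) \<in> odd_diagram n w \<longleftrightarrow> (i, j) \<in> odd_diagram n v" for i j
  proof (cases j)
    case 0
    then show ?thesis by (simp add: odd_diagram_def diagram_def)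
  next
    case (Suc j')
    then show ?thesis
      using odd_diagram_column[OF w, of j'] odd_diagram_column[OF v, of j'] assms(3)[of j'] by blast
  qed
  then show ?thesis by auto
qed

lemma odd_diagram_eq_imp_same_run:
  assumes u: "u permutes {1..n}" and v: "v permutes {1..n}" and eq: "odd_diagram n u = odd_diagram n v"
  shows "same_parities (places_above u j) (places_above v j) \<and>
         same_run (places_above u j) (next_index u j) (next_index v j)"
proof -
  have run: "same_run (places_above u j) (next_index u j) (next_index v j)"
    if "same_parities (places_above u j) (places_above v j)" for j
    using that odd_diagram_column[OF u, of j] odd_diagram_column[OF v, of j] eq
    by (intro same_run_of_opposite_before_eq[where h = "places_above v j"]
        strict_mono_places_above[OF u] strict_mono_places_above[OF v]) auto
  have "same_parities (places_above u j) (places_above v j)"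
  proof (induction j)
    case 0
    show ?case by (simp add: same_parities_def places_above_0[OF u] places_above_0[OF v])
  next
    case (Suc j)
    then show ?case
      unfolding places_above_Suc[OF u] places_above_Suc[OF v]
      by (intro same_parities_delete run)
  qed
  with run show ?thesis by blast
qed

text \<open>The parity pattern and interlacing are maintained together along \<open>j\<close>: they show that
\<open>w\<close> deletes from the run used by \<open>u\<close> and \<open>v\<close>, and this in turn preserves
both after the deletion.\<close>

lemma odd_diagram_between:
  assumes u: "u permutes {1..n}" and v: "v permutes {1..n}" and w: "w permutes {1..n}"
    and eq: "odd_diagram n u = odd_diagram n v" and uw: "rank_le u w" and wv: "rank_le w v"
  shows "odd_diagram n w = odd_diagram n u"
proof -
  let ?f = "places_above u" and ?g = "places_above w" and ?h = "places_above v"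
  let ?r = "next_index u" and ?s = "next_index w" and ?t = "next_index v"
  have le: "?g j i \<le> ?f j i" "?h j i \<le> ?g j i" for i j
    using rank_le_places_above u v w uw wv by blast+
  have step: "same_run (?g j) (?r j) (?s j) \<and> same_run (?g j) (?s j) (?t j)"
    if par: "same_parities (?f j) (?g j)" "same_parities (?g j) (?h j)"
      and lac: "interlaced (?f j) (?g j)" "interlaced (?g j) (?h j)" for j
  proof -
    have "same_run (?f j) (?r j) (?t j)"
      using odd_diagram_eq_imp_same_run[OF u v eq] by blast
    then have rt: "same_run (?g j) (?r j) (?t j)"
      using same_run_cong[OF par(1)] by blast
    have rs: "same_run (?g j) (?r j) (?s j)"
      using le[of "Suc j"]
      by (intro same_run_squeeze[OF par lac rt])
        (simp_all add: places_above_Suc[OF u] places_above_Suc[OF v] places_above_Suc[OF w])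
    with rt show ?thesis
      using same_run_sym same_run_trans by blast
  qed
  have inv: "same_parities (?f j) (?g j) \<and> same_parities (?g j) (?h j) \<and>
             interlaced (?f j) (?g j) \<and> interlaced (?g j) (?h j)" for j
  proof (induction j)
    case 0
    show ?case
      by (simp add: same_parities_def interlaced_def places_above_0[OF u] places_above_0[OF v]
          places_above_0[OF w])
  next
    case (Suc j)
    then have st: "same_run (?g j) (?r j) (?s j)" "same_run (?g j) (?s j) (?t j)"
      using step by blast+
    then have "same_run (?f j) (?r j) (?s j)"
      using Suc same_run_cong by blast
    with st(2) Suc show ?case
      unfolding places_above_Suc[OF u] places_above_Suc[OF v] places_above_Suc[OF w]
      by (auto intro: same_parities_delete interlaced_delete)
  qed
  show ?thesis
  proof (rule odd_diagram_eqI[OF w u])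
    fix j
    have col: "opposite_before (?f j) (?r j) = opposite_before (?h j) (?t j)"
      using odd_diagram_column[OF u, of j] odd_diagram_column[OF v, of j] eq by simp
    have par: "same_parities (?f j) (?g j)" "same_parities (?g j) (?h j)"
      using inv[of j] by blast+
    have run: "same_run (?g j) (?r j) (?s j)" "same_run (?g j) (?s j) (?t j)"
      using inv[of j] step[of j] by blast+
    show "opposite_before (?g j) (?s j) = opposite_before (?f j) (?r j)"
      by (rule opposite_before_squeeze[OF strict_mono_places_above[OF u]
            strict_mono_places_above[OF v] par run le col])
  qed
qed

theorem theorem2:
  fixes n :: nat and D :: "(nat \<times> nat) set"
  assumes "n > 0"
    and "D \<subseteq> {1..n} \<times> {1..n}"
    and "\<exists>w. w permutes {1..n} \<and> odd_diagram n w = D"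
  shows "\<exists>u v. u permutes {1..n} \<and> v permutes {1..n} \<and> bruhat_le n u v \<and>
           {w. w permutes {1..n} \<and> odd_diagram n w = D} =
           {w. w permutes {1..n} \<and> bruhat_le n u w \<and> bruhat_le n w v}"
proof -
  obtain u v where u: "u permutes {1..n}" "odd_diagram n u = D"
    and v: "v permutes {1..n}" "odd_diagram n v = D"
    and bounds: "\<And>w. w permutes {1..n} \<Longrightarrow> odd_diagram n w = D \<Longrightarrow> bruhat_le n u w \<and> bruhat_le n w v"
    using odd_diagram_class_bounds[OF assms(3)] by metis
  have "odd_diagram n w = D"
    if "w permutes {1..n}" "bruhat_le n u w" "bruhat_le n w v" for w
    using odd_diagram_between[OF u(1) v(1) that(1)] u(2) v(2) bruhat_le_imp_rank_le that by simp
  then have "{w. w permutes {1..n} \<and> odd_diagram n w = D} =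
             {w. w permutes {1..n} \<and> bruhat_le n u w \<and> bruhat_le n w v}"
    using bounds by blast
  moreover have "bruhat_le n u v"
    using bounds[OF v] by blast
  ultimately show ?thesis
    using u(1) v(1) by blast
qed

end
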